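(* Let $n>k$ be two positive integers. The maps $\psi:P(n,k)\to C(n,k)$ and $\sigma:C(n,k)\to P(n,k)$ defined by $$\psi(\mathcal{S})=\{E\subseteq\{1,2,\ldots,n\}\mid |E|=k+1,\ E\subseteq S\text{ for some }S\in\mathcal{S}\},$$ $$\sigma(\mathcal{D})=\text{the collection of sets of concurrencies in }\mathcal{D},$$ are poset isomorphisms and inverses of each other.
   Context: $P(n,k)$ is the set of all (possibly empty) collections $\{S_1,\ldots,S_r\}$ of distinct subsets of $\{1,\ldots,n\}$, each of cardinality at least $k+1$, such that $\left|\bigcup_{i\in I}S_i\right|>k+\sum_{i\in I}(|S_i|-k)$ for all $I\subseteq\{1,\ldots,r\}$ with $|I|\ge2$. It is partially ordered by: $\{S_1,\ldots,S_r\}\le\{T_1,\ldots,T_p\}$ if for each $1\le i\le r$ there exists $1\le j\le p$ with $S_i\subseteq T_j$. Let $\mathcal{E}$ be the collection of all $(k+1)$-subsets of $\{1,\ldots,n\}$. A collection $\mathcal{D}\subseteq\mathcal{E}$ is concurrency closed if every $S\in\mathcal{E}$ satisfying the following criterion belongs to $\mathcal{D}$: there exists $\{S_1,\ldots,S_r\}\subseteq\mathcal{D}$ (distinct sets, $S_i\ne S$ for all $i$) such that $\left|\bigcup_{j\in J}S_j\right|\ge k+|J|$ for every nonempty $J\subseteq\{1,\ldots,r\}$ and $\left|\bigcup_{i=1}^rS_i\cup S\right|<k+r+1$. $C(n,k)$ is the set of all concurrency closed subcollections of $\mathcal{E}$, partially ordered by inclusion. For a concurrency closed $\mathcal{D}$,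 a set of concurrency in $\mathcal{D}$ is a subset $D\subseteq\{1,\ldots,n\}$ with $|D|\ge k+1$, all of whose $(k+1)$-subsets belong to $\mathcal{D}$, and which is maximal under inclusion with this property. That $\psi$ takes values in $C(n,k)$ and $\sigma$ takes values in $P(n,k)$ is part of the assertion. *)

theory Defs
  imports Main "HOL-Library.FuncSet"
begin

text \<open>A collection \<open>{S\<^sub>1, \<dots>, S\<^sub>r}\<close> of distinct sets is a set of sets, and an index set
  \<open>I \<subseteq> {1, \<dots>, r}\<close> is a subcollection of it. Truncated subtraction on \<^typ>\<open>nat\<close> does not occur:
  \<open>card S - k\<close> is only used for sets with at least \<open>k + 1\<close> elements.\<close>

definition P :: "nat \<Rightarrow> nat \<Rightarrow> nat set set set" where
  "P n k = {\<S>. (\<forall>S\<in>\<S>. S \<subseteq> {1..n} \<and> card S \<ge> k + 1) \<and>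
               (\<forall>I\<subseteq>\<S>. card I \<ge> 2 \<longrightarrow> card (\<Union>I) > k + (\<Sum>S\<in>I. card S - k))}"

definition P_order :: "nat \<Rightarrow> nat \<Rightarrow> nat set set rel" where
  "P_order n k = {(\<S>, \<T>). \<S> \<in> P n k \<and> \<T> \<in> P n k \<and> (\<forall>S\<in>\<S>. \<exists>T\<in>\<T>. S \<subseteq> T)}"

definition \<E> :: "nat \<Rightarrow> nat \<Rightarrow> nat set set" where
  "\<E> n k = {E. E \<subseteq> {1..n} \<and> card E = k + 1}"

definition closure_criterion :: "nat \<Rightarrow> nat set set \<Rightarrow> nat set \<Rightarrow> bool" where
  "closure_criterion k \<D> S \<longleftrightarrow>
     (\<exists>\<F>\<subseteq>\<D>. S \<notin> \<F> \<and>
        (\<forall>J\<subseteq>\<F>. J \<noteq> {} \<longrightarrow> card (\<Union>J) \<ge> k + card J) \<and>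
        card (\<Union>\<F> \<union> S) < k + card \<F> + 1)"

definition concurrency_closed :: "nat \<Rightarrow> nat \<Rightarrow> nat set set \<Rightarrow> bool" where
  "concurrency_closed n k \<D> \<longleftrightarrow>
     \<D> \<subseteq> \<E> n k \<and> (\<forall>S\<in>\<E> n k. closure_criterion k \<D> S \<longrightarrow> S \<in> \<D>)"

definition C :: "nat \<Rightarrow> nat \<Rightarrow> nat set set set" where
  "C n k = {\<D>. concurrency_closed n k \<D>}"

definition C_order :: "nat \<Rightarrow> nat \<Rightarrow> nat set set rel" where
  "C_order n k = {(\<D>, \<D>'). \<D> \<in> C n k \<and> \<D>' \<in> C n k \<and> \<D> \<subseteq> \<D>'}"

definition concurrent :: "nat \<Rightarrow> nat \<Rightarrow> nat set set \<Rightarrow> nat set \<Rightarrow> bool" where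
  "concurrent n k \<D> D \<longleftrightarrow>
     D \<subseteq> {1..n} \<and> card D \<ge> k + 1 \<and> (\<forall>E\<subseteq>D. card E = k + 1 \<longrightarrow> E \<in> \<D>)"

definition set_of_concurrency :: "nat \<Rightarrow> nat \<Rightarrow> nat set set \<Rightarrow> nat set \<Rightarrow> bool" where
  "set_of_concurrency n k \<D> D \<longleftrightarrow>
     concurrent n k \<D> D \<and> (\<forall>D'. concurrent n k \<D> D' \<and> D \<subseteq> D' \<longrightarrow> D' = D)"

definition \<psi> :: "nat \<Rightarrow> nat \<Rightarrow> nat set set \<Rightarrow> nat set set" where
  "\<psi> n k \<S> = {E. E \<subseteq> {1..n} \<and> card E = k + 1 \<and> (\<exists>S\<in>\<S>. E \<subseteq> S)}"

definition \<sigma> :: "nat \<Rightarrow> nat \<Rightarrow> nat set set \<Rightarrow> nat set set" where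
  "\<sigma> n k \<D> = {D. set_of_concurrency n k \<D> D}"

definition poset_isomorphism ::
    "'a set \<Rightarrow> 'a rel \<Rightarrow> 'b set \<Rightarrow> 'b rel \<Rightarrow> ('a \<Rightarrow> 'b) \<Rightarrow> bool" where
  "poset_isomorphism A r B s f \<longleftrightarrow>
     partial_order_on A r \<and> partial_order_on B s \<and> bij_betw f A B \<and>
     (\<forall>x\<in>A. \<forall>y\<in>A. (x, y) \<in> r \<longleftrightarrow> (f x, f y) \<in> s)"

end

theory Submission
  imports Defs
begin

text \<open>
  Call a family of \<open>(k + 1)\<close>-sets independent if every nonempty subfamily \<open>J\<close> satisfies
  \<open>card (\<Union>J) \<ge> k + card J\<close>; the closure criterion for \<open>E\<close> says that some independent family
  inside \<open>\<D>\<close> spans \<open>E\<close>. The inequality defining \<^const>\<open>P\<close> says that the members of a collection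
  overlap so little that independence of families chosen inside the single members is never
  destroyed by putting these families together. The quantitative form of this is
  \<open>card_Union_shrink\<close>: when the members are cut down to subsets, the union loses no more elements
  than the members do together, so that the inequality, strict or not, is inherited by smaller sets.

  \<^const>\<open>\<psi>\<close> yields closed collections: split an independent family \<open>\<F>\<close> that spans \<open>E\<close> according to the
  members of \<open>\<S>\<close> containing its sets. If two or more members were involved, the inherited strict
  inequality would make \<open>\<Union>\<F>\<close> larger than \<open>k + card \<F>\<close>. So \<open>\<Union>\<F>\<close>, and with it \<open>E\<close>, lies in a
  single member.

  \<^const>\<open>\<sigma>\<close> yields members of \<^const>\<open>P\<close>: take a smallest collection of at least two sets of
  concurrency that violates the inequality. Shrinking one of its sets without changing the union
  turns the violation into an equality, and all smaller subcollections still satisfy the weak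
  inequality. Then independent families inside the sets combine to an independent family that spans
  the whole union (\<open>independent_family_exists\<close>). Closedness makes the union concurrent, which
  contradicts the maximality of the sets.

  That the two maps are inverse to each other rests on one further consequence of the inequality:
  distinct members of \<open>\<S> \<in> P n k\<close> share fewer than \<open>k\<close> elements, so a set all of whose
  \<open>(k + 1)\<close>-subsets are covered by members of \<open>\<S>\<close> cannot spread over two members.
\<close>

section \<open>Independent families of sets\<close>

lemma card_Union_shrink:
  fixes D T :: "'i \<Rightarrow> 'a set"
  assumes "finite I" and "\<And>i. i \<in> I \<Longrightarrow> finite (D i)"
    and "\<And>i. i \<in> I \<Longrightarrow> T i \<subseteq> D i" and "\<And>i. i \<in> I \<Longrightarrow> k \<le> card (T i)"
  shows "(\<Sum>i\<in>I. card (T i) - k) + card (\<Union>i\<in>I. D i)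
       \<le> (\<Sum>i\<in>I. card (D i) - k) + card (\<Union>i\<in>I. T i)"
proof -
  have finT: "finite (T i)" if "i \<in> I" for i
    using assms(2,3) that finite_subset by blast
  have "card (\<Union>i\<in>I. D i) \<le> card ((\<Union>i\<in>I. T i) \<union> (\<Union>i\<in>I. D i - T i))"
    using assms(1,2) finT by (intro card_mono) auto
  also have "\<dots> \<le> card (\<Union>i\<in>I. T i) + card (\<Union>i\<in>I. D i - T i)"
    by (rule card_Un_le)
  also have "card (\<Union>i\<in>I. D i - T i) \<le> (\<Sum>i\<in>I. card (D i - T i))"
    using assms(1) by (rule card_UN_le)
  finally have le: "card (\<Union>i\<in>I. D i) \<le> card (\<Union>i\<in>I. T i) + (\<Sum>i\<in>I. card (D i - T i))"
    by simp
  have "card (D i) - k = (card (T i) - k) + card (D i - T i)" if "i \<in> I" for i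
  proof -
    have "card (D i) = card (T i) + card (D i - T i)"
      using card_Diff_subset[OF finT assms(3)] card_mono[OF assms(2) assms(3)] that by simp
    then show ?thesis
      using assms(4)[OF that] by simp
  qed
  then have "(\<Sum>i\<in>I. card (D i) - k) = (\<Sum>i\<in>I. card (T i) - k) + (\<Sum>i\<in>I. card (D i - T i))"
    by (simp add: sum.distrib)
  with le show ?thesis by simp
qed

text \<open>The sets that arise from a fixed \<open>k\<close>-subset of \<open>T\<close> by adding one further element of \<open>T\<close> form
  a tight family: each additional set contributes exactly one new element to the union.\<close>

lemma tight_family_exists:
  fixes T :: "'a set"
  assumes "finite T" and "k \<le> card T"
  obtains F where "card F = card T - k" and "\<And>E. E \<in> F \<Longrightarrow> E \<subseteq> T \<and> card E = k + 1"
    and "\<And>J. J \<subseteq> F \<Longrightarrow> J \<noteq> {} \<Longrightarrow> card (\<Union>J) = k + card J"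
proof -
  obtain A where A: "A \<subseteq> T" "card A = k" "finite A"
    using obtain_subset_with_card_n[OF assms(2)] by blast
  let ?F = "(\<lambda>x. insert x A) ` (T - A)"
  have inj: "inj_on (\<lambda>x. insert x A) (T - A)"
    by (rule inj_onI) blast
  have "card ?F = card T - k"
    using A by (simp add: card_image[OF inj] card_Diff_subset)
  moreover have "E \<subseteq> T \<and> card E = k + 1" if "E \<in> ?F" for E
    using that A by auto
  moreover have "card (\<Union>J) = k + card J" if "J \<subseteq> ?F" "J \<noteq> {}" for J
  proof -
    obtain X where X: "X \<subseteq> T - A" "J = (\<lambda>x. insert x A) ` X"
      using \<open>J \<subseteq> ?F\<close> by (auto simp: subset_image_iff)
    have "\<Union>J = A \<union> X"
      using X(2) \<open>J \<noteq> {}\<close> by auto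
    moreover have "card (A \<union> X) = k + card X"
      using A X(1) assms(1) by (subst card_Un_disjoint) (auto intro: finite_subset)
    moreover have "card J = card X"
      using X(2) inj_on_subset[OF inj X(1)] by (simp add: card_image)
    ultimately show ?thesis by simp
  qed
  ultimately show thesis by (rule that)
qed

text \<open>The union of tight families inside the sets \<open>T i\<close> is again independent: a subfamily \<open>J\<close> cuts
  each \<open>T i\<close> down to the union of those sets of \<open>J\<close> that come from \<open>T i\<close>, and \<open>card_Union_shrink\<close>
  carries the hypothesis over to these smaller sets.\<close>

lemma independent_family_exists:
  fixes T :: "'i \<Rightarrow> 'a set"
  assumes "finite I" and fin: "\<And>i. i \<in> I \<Longrightarrow> finite (T i)"
    and kT: "\<And>i. i \<in> I \<Longrightarrow> k \<le> card (T i)"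
    and large: "\<And>I'. I' \<subseteq> I \<Longrightarrow> I' \<noteq> {} \<Longrightarrow>
      k + (\<Sum>i\<in>I'. card (T i) - k) \<le> card (\<Union>i\<in>I'. T i)"
  obtains F where "card F = (\<Sum>i\<in>I. card (T i) - k)"
    and "\<forall>E\<in>F. card E = k + 1 \<and> (\<exists>i\<in>I. E \<subseteq> T i)"
    and "\<forall>J\<subseteq>F. J \<noteq> {} \<longrightarrow> k + card J \<le> card (\<Union>J)"
proof -
  have "\<exists>F. card F = card (T i) - k \<and> (\<forall>E\<in>F. E \<subseteq> T i \<and> card E = k + 1) \<and>
      (\<forall>J\<subseteq>F. J \<noteq> {} \<longrightarrow> card (\<Union>J) = k + card J)" if "i \<in> I" for i
    using tight_family_exists[OF fin[OF that] kT[OF that]] by metis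
  then obtain f where f: "\<And>i. i \<in> I \<Longrightarrow> card (f i) = card (T i) - k"
      "\<And>i E. i \<in> I \<Longrightarrow> E \<in> f i \<Longrightarrow> E \<subseteq> T i \<and> card E = k + 1"
      "\<And>i J. i \<in> I \<Longrightarrow> J \<subseteq> f i \<Longrightarrow> J \<noteq> {} \<Longrightarrow> card (\<Union>J) = k + card J"
    by metis
  have finf: "finite (f i)" if "i \<in> I" for i
    using f(2)[OF that] fin[OF that] by (intro finite_subset[of "f i" "Pow (T i)"]) auto
  have indep: "k + (\<Sum>i | i \<in> I \<and> J \<inter> f i \<noteq> {}. card (J \<inter> f i)) \<le> card (\<Union>J)"
    if J: "J \<subseteq> (\<Union>i\<in>I. f i)" "J \<noteq> {}" for J
  proof -
    let ?I = "{i \<in> I. J \<inter> f i \<noteq> {}}"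
    let ?U = "\<lambda>i. \<Union>(J \<inter> f i)"
    have U: "card (?U i) = k + card (J \<inter> f i)" "?U i \<subseteq> T i" if "i \<in> ?I" for i
      using that f(2,3)[of i] by auto
    have ne: "?I \<noteq> {}" using J by blast
    have "(\<Sum>i\<in>?I. card (?U i) - k) + card (\<Union>i\<in>?I. T i)
        \<le> (\<Sum>i\<in>?I. card (T i) - k) + card (\<Union>i\<in>?I. ?U i)"
      using \<open>finite I\<close> fin U by (intro card_Union_shrink) auto
    moreover have "k + (\<Sum>i\<in>?I. card (T i) - k) \<le> card (\<Union>i\<in>?I. T i)"
      by (rule large) (use ne in auto)
    moreover have "(\<Sum>i\<in>?I. card (?U i) - k) = (\<Sum>i\<in>?I. card (J \<inter> f i))"
      by (rule sum.cong) (simp_all add: U(1))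
    moreover have "(\<Union>i\<in>?I. ?U i) = \<Union>J"
      using J(1) by blast
    ultimately show ?thesis by simp
  qed
  \<comment> \<open>A set common to two of the families would be counted twice by \<open>indep\<close>, although it has only
    \<open>k + 1\<close> elements.\<close>
  have disj: "f i \<inter> f j = {}" if "i \<in> I" "j \<in> I" "i \<noteq> j" for i j
  proof (rule ccontr)
    assume "f i \<inter> f j \<noteq> {}"
    then obtain E where E: "E \<in> f i" "E \<in> f j" by blast
    have "2 = (\<Sum>l\<in>{i, j}. card ({E} \<inter> f l))"
      using E that by simp
    also have "\<dots> \<le> (\<Sum>l | l \<in> I \<and> {E} \<inter> f l \<noteq> {}. card ({E} \<inter> f l))"
      using E that \<open>finite I\<close> by (intro sum_mono2) auto
    finally show False
      using indep[of "{E}"] E that f(2)[of i E] by auto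
  qed
  have "card (\<Union>i\<in>I. f i) = (\<Sum>i\<in>I. card (T i) - k)"
    using \<open>finite I\<close> finf disj f(1) by (subst card_UN_disjoint) auto
  moreover have "\<forall>E\<in>(\<Union>i\<in>I. f i). card E = k + 1 \<and> (\<exists>i\<in>I. E \<subseteq> T i)"
    using f(2) by blast
  moreover have "k + card J \<le> card (\<Union>J)" if J: "J \<subseteq> (\<Union>i\<in>I. f i)" "J \<noteq> {}" for J
  proof -
    have "J = (\<Union>i\<in>{i \<in> I. J \<inter> f i \<noteq> {}}. J \<inter> f i)"
      using J(1) by blast
    then have "card J \<le> (\<Sum>i | i \<in> I \<and> J \<inter> f i \<noteq> {}. card (J \<inter> f i))"
      using card_UN_le[of "{i \<in> I. J \<inter> f i \<noteq> {}}" "\<lambda>i. J \<inter> f i"] \<open>finite I\<close> by simp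
    then show ?thesis
      using indep[OF J] by simp
  qed
  ultimately show thesis by (intro that) auto
qed

section \<open>Sets of concurrency of a closed collection\<close>

text \<open>The hypothesis \<open>tight\<close> says that the independent family found inside the sets \<open>T i\<close> has as many
  members as the size of their union allows, so it spans every \<open>(k + 1)\<close>-subset of the union.\<close>

lemma concurrency_closed_tight_union:
  assumes closed: "concurrency_closed n k \<D>"
    and "finite I" and T: "\<And>i. i \<in> I \<Longrightarrow> T i \<subseteq> {1..n}" "\<And>i. i \<in> I \<Longrightarrow> k \<le> card (T i)"
    and inD: "\<And>i E. i \<in> I \<Longrightarrow> E \<subseteq> T i \<Longrightarrow> card E = k + 1 \<Longrightarrow> E \<in> \<D>"
    and large: "\<And>I'. I' \<subseteq> I \<Longrightarrow> I' \<noteq> {} \<Longrightarrow>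
      k + (\<Sum>i\<in>I'. card (T i) - k) \<le> card (\<Union>i\<in>I'. T i)"
    and tight: "card (\<Union>i\<in>I. T i) = k + (\<Sum>i\<in>I. card (T i) - k)"
    and E: "E \<subseteq> (\<Union>i\<in>I. T i)" "card E = k + 1"
  shows "E \<in> \<D>"
proof (rule ccontr)
  assume "E \<notin> \<D>"
  have fin: "finite (T i)" if "i \<in> I" for i
    using T(1)[OF that] by (rule finite_subset) simp
  obtain F where F: "card F = (\<Sum>i\<in>I. card (T i) - k)"
      "\<forall>E\<in>F. card E = k + 1 \<and> (\<exists>i\<in>I. E \<subseteq> T i)"
      "\<forall>J\<subseteq>F. J \<noteq> {} \<longrightarrow> k + card J \<le> card (\<Union>J)"
    by (rule independent_family_exists[OF \<open>finite I\<close> fin T(2) large])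
  have FD: "F \<subseteq> \<D>" using F(2) inD by blast
  have "\<Union>F \<union> E \<subseteq> (\<Union>i\<in>I. T i)" using F(2) E(1) by blast
  then have "card (\<Union>F \<union> E) \<le> card (\<Union>i\<in>I. T i)"
    using \<open>finite I\<close> fin by (intro card_mono) auto
  then have "card (\<Union>F \<union> E) < k + card F + 1"
    using tight F(1) by simp
  then have "closure_criterion k \<D> E"
    unfolding closure_criterion_def using FD \<open>E \<notin> \<D>\<close> F(3) by blast
  moreover have "E \<in> \<E> n k"
    unfolding \<E>_def using E T(1) by blast
  ultimately show False
    using closed \<open>E \<notin> \<D>\<close> unfolding concurrency_closed_def by blast
qed

text \<open>A smallest violating \<open>I\<close> would have a concurrent union. To see this, remove
  one member \<open>D0\<close> from \<open>I\<close> and replace it by a subset that still contains all elements of \<open>D0\<close>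
  outside the other members, of a size for which the violated inequality becomes an equality.
  The inequality for the other members ensures that this size suffices. The replacement may end up
  with only \<open>k\<close> elements, which is why the preceding lemmas allow sets of that size.\<close>

lemma sets_of_concurrency_large_union:
  assumes closed: "concurrency_closed n k \<D>"
  shows "I \<subseteq> \<sigma> n k \<D> \<Longrightarrow> 2 \<le> card I \<Longrightarrow> k + (\<Sum>S\<in>I. card S - k) < card (\<Union>I)"
proof (induction "card I" arbitrary: I rule: less_induct)
  case less
  have finI: "finite I" using less.prems(2) by (intro card_ge_0_finite) simp
  have conc: "S \<subseteq> {1..n}" "k + 1 \<le> card S" "\<And>E. E \<subseteq> S \<Longrightarrow> card E = k + 1 \<Longrightarrow> E \<in> \<D>"
    if "S \<in> I" for S
    using that less.prems(1) by (auto simp: \<sigma>_def set_of_concurrency_def concurrent_def)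
  have finS: "finite S" if "S \<in> I" for S
    using conc(1)[OF that] by (rule finite_subset) simp
  have proper: "k + (\<Sum>S\<in>I'. card S - k) \<le> card (\<Union>I')" if "I' \<subset> I" "I' \<noteq> {}" for I'
  proof (cases "2 \<le> card I'")
    case True
    have "card I' < card I" using that(1) finI by (simp add: psubset_card_mono)
    then show ?thesis
      using less.hyps[of I'] True that(1) less.prems(1)
      by (meson less_imp_le psubset_imp_subset subset_trans)
  next
    case False
    have "card I' \<noteq> 0" using that finI by (auto dest: finite_subset)
    with False have "card I' = 1" by simp
    then obtain S where "I' = {S}" by (auto simp: card_1_singleton_iff)
    then have "S \<in> I" using that(1) by blast
    then show ?thesis using conc(2)[of S] \<open>I' = {S}\<close> by simp
  qed
  show ?case
  proof (rule ccontr)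
    assume "\<not> ?case"
    then have small: "card (\<Union>I) \<le> k + (\<Sum>S\<in>I. card S - k)" by simp
    obtain D0 where D0: "D0 \<in> I" using less.prems(2) by fastforce
    let ?O = "I - {D0}"
    have One: "?O \<noteq> {}" using less.prems(2) D0 finI card_Diff_singleton[OF D0]
      by (metis card.empty diff_is_0_eq not_less_eq_eq numeral_2_eq_2 One_nat_def)
    have O_large: "k + (\<Sum>S\<in>?O. card S - k) \<le> card (\<Union>?O)"
      by (rule proper) (use D0 One in auto)
    have sumI: "(\<Sum>S\<in>I. card S - k) = (card D0 - k) + (\<Sum>S\<in>?O. card S - k)"
      using finI D0 by (rule sum.remove)
    have finU: "finite (\<Union>I)" using finI finS by blast
    have split: "card (\<Union>I) = card (\<Union>?O) + card (D0 - \<Union>?O)"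
    proof -
      have "\<Union>I = \<Union>?O \<union> (D0 - \<Union>?O)" using D0 by blast
      then show ?thesis
        by (metis Diff_disjoint card_Un_disjoint finU finite_Un)
    qed
    \<comment> \<open>The room that the other members leave: the replacement of \<open>D0\<close> gets \<open>k + f\<close> elements.\<close>
    define f where "f = card (\<Union>I) - (k + (\<Sum>S\<in>?O. card S - k))"
    have cardI: "card (\<Union>I) = k + (\<Sum>S\<in>?O. card S - k) + f"
      using O_large split by (simp add: f_def)
    have "card (D0 - \<Union>?O) \<le> k + f"
      using cardI split O_large by simp
    moreover have "k + f \<le> card D0"
      using small sumI cardI conc(2)[OF D0] by simp
    ultimately obtain T0 where T0: "D0 - \<Union>?O \<subseteq> T0" "T0 \<subseteq> D0" "card T0 = k + f"
      using exists_subset_between[of "D0 - \<Union>?O" "k + f" D0] finS[OF D0] by blast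
    define T where "T = (\<lambda>S. if S = D0 then T0 else S)"
    have T: "T S \<subseteq> S" "k \<le> card (T S)" if "S \<in> I" for S
      using that T0 conc(2)[OF that] by (auto simp: T_def)
    have "(\<Union>S\<in>I. T S) = T0 \<union> (\<Union>S\<in>?O. T S)"
      using D0 by (auto simp: T_def)
    also have "(\<Union>S\<in>?O. T S) = \<Union>?O"
      by (auto simp: T_def)
    also have "T0 \<union> \<Union>?O = D0 \<union> \<Union>?O"
      using T0(1,2) by blast
    also have "\<dots> = \<Union>I"
      using D0 by blast
    finally have UT: "(\<Union>S\<in>I. T S) = \<Union>I" .
    have "(\<Sum>S\<in>I. card (T S) - k) = (card (T D0) - k) + (\<Sum>S\<in>?O. card (T S) - k)"
      using finI D0 by (rule sum.remove)
    also have "(\<Sum>S\<in>?O. card (T S) - k) = (\<Sum>S\<in>?O. card S - k)"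
      by (rule sum.cong) (auto simp: T_def)
    finally have tight: "card (\<Union>S\<in>I. T S) = k + (\<Sum>S\<in>I. card (T S) - k)"
      unfolding UT cardI using T0(3) by (simp add: T_def)
    have large: "k + (\<Sum>S\<in>I'. card (T S) - k) \<le> card (\<Union>S\<in>I'. T S)"
      if I': "I' \<subseteq> I" "I' \<noteq> {}" for I'
    proof (cases "I' = I")
      case True
      then show ?thesis using tight by simp
    next
      case False
      then have "k + (\<Sum>S\<in>I'. card S - k) \<le> card (\<Union>S\<in>I'. S)"
        using proper[of I'] I' by auto
      moreover have "(\<Sum>S\<in>I'. card (T S) - k) + card (\<Union>S\<in>I'. S)
          \<le> (\<Sum>S\<in>I'. card S - k) + card (\<Union>S\<in>I'. T S)"
        using I' finI finS T by (intro card_Union_shrink) (auto intro: finite_subset)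
      ultimately show ?thesis by simp
    qed
    have "E \<in> \<D>" if "E \<subseteq> \<Union>I" "card E = k + 1" for E
    proof (rule concurrency_closed_tight_union[OF closed finI _ _ _ large tight])
      show "T S \<subseteq> {1..n}" "k \<le> card (T S)" if "S \<in> I" for S
        using T[OF that] conc(1)[OF that] by auto
      show "E' \<in> \<D>" if "S \<in> I" "E' \<subseteq> T S" "card E' = k + 1" for S E'
        using T(1)[OF that(1)] conc(3)[OF that(1)] that by blast
    qed (use that UT in auto)
    moreover have "k + 1 \<le> card (\<Union>I)"
      using conc(2)[OF D0] card_mono[OF finU Union_upper[OF D0]] by simp
    ultimately have "concurrent n k \<D> (\<Union>I)"
      unfolding concurrent_def using conc(1) by blast
    then have "S = \<Union>I" if "S \<in> I" for S
      using that less.prems(1) unfolding \<sigma>_def set_of_concurrency_def by blast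
    then have "I \<subseteq> {\<Union>I}" by blast
    then have "card I \<le> 1" using card_mono[of "{\<Union>I}" I] by simp
    then show False using less.prems(2) by simp
  qed
qed

lemma \<sigma>_in_P:
  assumes "\<D> \<in> C n k"
  shows "\<sigma> n k \<D> \<in> P n k"
  using assms sets_of_concurrency_large_union[of n k \<D>]
  by (auto simp: P_def C_def \<sigma>_def set_of_concurrency_def concurrent_def)

section \<open>The closed collection generated by a member of \<open>P\<close>\<close>

lemma P_finite:
  assumes "\<S> \<in> P n k"
  shows "finite \<S>"
proof (rule finite_subset)
  show "\<S> \<subseteq> Pow {1..n}" using assms by (auto simp: P_def)
qed simp

lemma \<psi>_in_C:
  assumes S: "\<S> \<in> P n k"
  shows "\<psi> n k \<S> \<in> C n k"
proof -
  have "E \<in> \<psi> n k \<S>" if E: "E \<in> \<E> n k" and crit: "closure_criterion k (\<psi> n k \<S>) E" for E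
  proof -
    obtain F where F: "F \<subseteq> \<psi> n k \<S>"
        "\<And>J. J \<subseteq> F \<Longrightarrow> J \<noteq> {} \<Longrightarrow> k + card J \<le> card (\<Union>J)"
        "card (\<Union>F \<union> E) < k + card F + 1"
      using crit unfolding closure_criterion_def by auto
    have cardE: "card E = k + 1" and Esub: "E \<subseteq> {1..n}" using E by (auto simp: \<E>_def)
    have Fsub: "F \<subseteq> Pow {1..n}" using F(1) by (auto simp: \<psi>_def)
    have "\<Union>F \<union> E \<subseteq> {1..n}" using Fsub Esub by blast
    then have finU: "finite (\<Union>F \<union> E)" by (rule finite_subset) simp
    have Fne: "F \<noteq> {}" using F(3) cardE by auto
    let ?I = "{S \<in> \<S>. F \<inter> Pow S \<noteq> {}}"
    let ?U = "\<lambda>S. \<Union>(F \<inter> Pow S)"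
    have cover: "(\<Union>S\<in>?I. F \<inter> Pow S) = F"
    proof (intro equalityI subsetI)
      fix E' assume "E' \<in> F"
      moreover from this obtain S where "S \<in> \<S>" "E' \<subseteq> S" using F(1) unfolding \<psi>_def by blast
      ultimately have "S \<in> ?I" "E' \<in> F \<inter> Pow S" by auto
      then show "E' \<in> (\<Union>S\<in>?I. F \<inter> Pow S)" by blast
    qed blast
    have finI: "finite ?I" using P_finite[OF S] by simp
    have finS: "finite S" if "S \<in> \<S>" for S
    proof (rule finite_subset)
      show "S \<subseteq> {1..n}" using S that by (simp add: P_def)
    qed simp
    have U: "k + card (F \<inter> Pow S) \<le> card (?U S)" if "S \<in> ?I" for S
      using that F(2)[of "F \<inter> Pow S"] by auto
    \<comment> \<open>Two members would force \<open>\<Union>F\<close> to have more than \<open>k + card F\<close> elements.\<close>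
    have "\<not> 2 \<le> card ?I"
    proof
      assume two: "2 \<le> card ?I"
      have "\<forall>I\<subseteq>\<S>. 2 \<le> card I \<longrightarrow> k + (\<Sum>S\<in>I. card S - k) < card (\<Union>I)"
        using S by (simp add: P_def)
      from this[rule_format, of ?I]
      have "k + (\<Sum>S\<in>?I. card S - k) < card (\<Union>S\<in>?I. S)"
        using two by simp
      moreover have "(\<Sum>S\<in>?I. card (?U S) - k) + card (\<Union>S\<in>?I. S)
          \<le> (\<Sum>S\<in>?I. card S - k) + card (\<Union>S\<in>?I. ?U S)"
        using finI finS U by (intro card_Union_shrink) (auto intro: add_leD1)
      moreover have "(\<Sum>S\<in>?I. card (F \<inter> Pow S)) \<le> (\<Sum>S\<in>?I. card (?U S) - k)"
        using U by (intro sum_mono) fastforce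
      moreover have "card F \<le> (\<Sum>S\<in>?I. card (F \<inter> Pow S))"
        using card_UN_le[OF finI, of "\<lambda>S. F \<inter> Pow S"] cover by simp
      moreover have "card (\<Union>S\<in>?I. ?U S) \<le> card (\<Union>F \<union> E)"
        using finU by (intro card_mono) auto
      ultimately show False using F(3) by simp
    qed
    moreover have "?I \<noteq> {}" using cover Fne by blast
    then have "card ?I \<noteq> 0" using finI by (simp only: card_0_eq not_False_eq_True)
    ultimately have "card ?I = 1" by linarith
    then obtain S where "?I = {S}" by (auto simp: card_1_singleton_iff)
    then have SS: "S \<in> \<S>" "\<Union>F \<subseteq> S" using cover by auto
    have "card (\<Union>F \<union> E) \<le> card (\<Union>F)"
      using F(2)[of F] F(3) Fne by simp
    then have "\<Union>F = \<Union>F \<union> E"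
      using finU by (intro card_seteq) auto
    then show ?thesis
      using SS cardE Esub by (auto simp: \<psi>_def)
  qed
  then show ?thesis
    by (auto simp: C_def concurrency_closed_def \<psi>_def \<E>_def)
qed

section \<open>The two maps are inverse to each other\<close>

lemma P_members_share_fewer:
  assumes S: "\<S> \<in> P n k" and "S \<in> \<S>" "S' \<in> \<S>" "S \<noteq> S'"
  shows "card (S \<inter> S') < k"
proof -
  have fin: "finite S" "finite S'" and ge: "k + 1 \<le> card S" "k + 1 \<le> card S'"
    using assms by (auto simp: P_def intro: finite_subset[of _ "{1..n}"])
  have "\<forall>I\<subseteq>\<S>. 2 \<le> card I \<longrightarrow> k + (\<Sum>S\<in>I. card S - k) < card (\<Union>I)"
    using S by (simp add: P_def)
  from this[rule_format, of "{S, S'}"]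
  have "k + ((card S - k) + (card S' - k)) < card (S \<union> S')"
    using assms(2-4) by simp
  then show ?thesis
    using card_Un_Int[OF fin] ge by simp
qed

text \<open>A member \<open>S\<close> containing one \<open>(k + 1)\<close>-subset of \<open>D\<close> already contains \<open>D\<close>: for \<open>x \<in> D - S\<close>, the
  member that contains \<open>x\<close> together with \<open>k\<close> elements of \<open>S \<inter> D\<close> would share these \<open>k\<close> elements
  with \<open>S\<close>.\<close>

lemma concurrent_\<psi>_iff:
  assumes S: "\<S> \<in> P n k"
  shows "concurrent n k (\<psi> n k \<S>) D \<longleftrightarrow>
    D \<subseteq> {1..n} \<and> k + 1 \<le> card D \<and> (\<exists>S\<in>\<S>. D \<subseteq> S)"
proof
  assume conc: "concurrent n k (\<psi> n k \<S>) D"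
  then have D: "D \<subseteq> {1..n}" "k + 1 \<le> card D"
    and sub: "\<And>E. E \<subseteq> D \<Longrightarrow> card E = k + 1 \<Longrightarrow> \<exists>S\<in>\<S>. E \<subseteq> S"
    by (auto simp: concurrent_def \<psi>_def)
  obtain E where E: "E \<subseteq> D" "card E = k + 1"
    using obtain_subset_with_card_n[OF D(2)] by blast
  then obtain S where SS: "S \<in> \<S>" "E \<subseteq> S" using sub by blast
  have "k \<le> card E" using E(2) by simp
  then obtain A where A: "A \<subseteq> E" "card A = k" "finite A"
    by (rule obtain_subset_with_card_n)
  have "D \<subseteq> S"
  proof (rule ccontr)
    assume "\<not> D \<subseteq> S"
    then obtain x where x: "x \<in> D" "x \<notin> S" by blast
    have "x \<notin> A" using x(2) A(1) SS(2) by blast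
    then have "insert x A \<subseteq> D" "card (insert x A) = k + 1"
      using x A E(1) by auto
    then obtain S' where S': "S' \<in> \<S>" "insert x A \<subseteq> S'" using sub by blast
    have "S \<subseteq> {1..n}" using S SS(1) by (simp add: P_def)
    then have "finite S" by (rule finite_subset) simp
    then have "card A \<le> card (S \<inter> S')"
      using A(1) SS(2) S'(2) by (intro card_mono) auto
    moreover have "S \<noteq> S'" using x(2) S'(2) by blast
    ultimately show False
      using P_members_share_fewer[OF S SS(1) S'(1)] A(2) by simp
  qed
  then show "D \<subseteq> {1..n} \<and> k + 1 \<le> card D \<and> (\<exists>S\<in>\<S>. D \<subseteq> S)"
    using D SS(1) by blast
next
  assume "D \<subseteq> {1..n} \<and> k + 1 \<le> card D \<and> (\<exists>S\<in>\<S>. D \<subseteq> S)"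
  then show "concurrent n k (\<psi> n k \<S>) D"
    unfolding concurrent_def \<psi>_def by blast
qed

lemma P_antichain:
  assumes "\<S> \<in> P n k" "S \<in> \<S>" "S' \<in> \<S>" "S \<subseteq> S'"
  shows "S = S'"
proof (rule ccontr)
  assume "S \<noteq> S'"
  then have "card S < k"
    using P_members_share_fewer[OF assms(1-3)] assms(4) by (simp add: Int_absorb2)
  then show False using assms(1,2) by (auto simp: P_def)
qed

lemma \<sigma>_\<psi>:
  assumes S: "\<S> \<in> P n k"
  shows "\<sigma> n k (\<psi> n k \<S>) = \<S>"
proof -
  have bounds: "S \<subseteq> {1..n}" "k + 1 \<le> card S" if "S \<in> \<S>" for S
    using S that by (auto simp: P_def)
  show ?thesis
  proof (intro equalityI subsetI)
    fix D assume "D \<in> \<sigma> n k (\<psi> n k \<S>)"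
    then show "D \<in> \<S>"
      unfolding \<sigma>_def set_of_concurrency_def concurrent_\<psi>_iff[OF S] using bounds by blast
  next
    fix D assume D: "D \<in> \<S>"
    have "D' = D" if conc: "concurrent n k (\<psi> n k \<S>) D'" and "D \<subseteq> D'" for D'
    proof -
      obtain S where "S \<in> \<S>" "D' \<subseteq> S"
        using conc unfolding concurrent_\<psi>_iff[OF S] by blast
      then show ?thesis
        using P_antichain[OF S D, of S] that(2) by blast
    qed
    moreover have "concurrent n k (\<psi> n k \<S>) D"
      using D bounds[OF D] unfolding concurrent_\<psi>_iff[OF S] by blast
    ultimately show "D \<in> \<sigma> n k (\<psi> n k \<S>)"
      by (simp add: \<sigma>_def set_of_concurrency_def)
  qed
qed

lemma concurrent_imp_subset_set_of_concurrency:
  assumes "concurrent n k \<D> E"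
  obtains D where "set_of_concurrency n k \<D> D" "E \<subseteq> D"
proof -
  have "finite {D. concurrent n k \<D> D}"
    by (rule finite_subset[of _ "Pow {1..n}"]) (auto simp: concurrent_def)
  from finite_has_maximal2[OF this, of E] assms
  show thesis using that unfolding set_of_concurrency_def by auto
qed

lemma \<psi>_\<sigma>:
  assumes "\<D> \<subseteq> \<E> n k"
  shows "\<psi> n k (\<sigma> n k \<D>) = \<D>"
proof (intro equalityI subsetI)
  fix E assume "E \<in> \<psi> n k (\<sigma> n k \<D>)"
  then show "E \<in> \<D>"
    by (auto simp: \<psi>_def \<sigma>_def set_of_concurrency_def concurrent_def)
next
  fix E assume "E \<in> \<D>"
  then have E: "E \<subseteq> {1..n}" "card E = k + 1" using assms by (auto simp: \<E>_def)
  have "E' = E" if "E' \<subseteq> E" "card E' = k + 1" for E'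
    using that E by (intro card_subset_eq) (auto intro: finite_subset)
  then have "concurrent n k \<D> E"
    using E \<open>E \<in> \<D>\<close> by (auto simp: concurrent_def)
  then obtain D where "set_of_concurrency n k \<D> D" "E \<subseteq> D"
    by (rule concurrent_imp_subset_set_of_concurrency)
  then show "E \<in> \<psi> n k (\<sigma> n k \<D>)"
    using E by (auto simp: \<psi>_def \<sigma>_def)
qed

section \<open>The partial orders\<close>

lemma P_order_iff_\<psi>_subset:
  assumes S: "\<S> \<in> P n k" and T: "\<T> \<in> P n k"
  shows "(\<S>, \<T>) \<in> P_order n k \<longleftrightarrow> \<psi> n k \<S> \<subseteq> \<psi> n k \<T>"
proof
  assume "(\<S>, \<T>) \<in> P_order n k"
  then have le: "\<And>S. S \<in> \<S> \<Longrightarrow> \<exists>T\<in>\<T>. S \<subseteq> T" by (simp add: P_order_def)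
  show "\<psi> n k \<S> \<subseteq> \<psi> n k \<T>"
  proof
    fix E assume "E \<in> \<psi> n k \<S>"
    then obtain S where E: "E \<subseteq> {1..n}" "card E = k + 1" and "S \<in> \<S>" "E \<subseteq> S"
      unfolding \<psi>_def by blast
    moreover obtain T where "T \<in> \<T>" "S \<subseteq> T" using le[OF \<open>S \<in> \<S>\<close>] by blast
    ultimately have "\<exists>T\<in>\<T>. E \<subseteq> T" by blast
    with E show "E \<in> \<psi> n k \<T>" by (simp add: \<psi>_def)
  qed
next
  assume sub: "\<psi> n k \<S> \<subseteq> \<psi> n k \<T>"
  have "\<exists>T\<in>\<T>. S \<subseteq> T" if "S \<in> \<S>" for S
  proof -
    have "S \<subseteq> {1..n}" "k + 1 \<le> card S" using S that by (auto simp: P_def)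
    then have "concurrent n k (\<psi> n k \<S>) S"
      using that unfolding concurrent_\<psi>_iff[OF S] by blast
    then have "concurrent n k (\<psi> n k \<T>) S"
      using sub unfolding concurrent_def by blast
    then show ?thesis
      unfolding concurrent_\<psi>_iff[OF T] by blast
  qed
  then show "(\<S>, \<T>) \<in> P_order n k"
    using S T by (simp add: P_order_def)
qed

text \<open>Only \<open>s\<close> is assumed to be a partial order; its laws are transported along \<open>f\<close>. In this way the
  antisymmetry of \<^const>\<open>P_order\<close> comes from that of inclusion.\<close>

lemma poset_isomorphism_inverse_pair:
  assumes s: "partial_order_on B s" and r: "r \<subseteq> A \<times> A"
    and f: "\<And>x. x \<in> A \<Longrightarrow> f x \<in> B" and g: "\<And>y. y \<in> B \<Longrightarrow> g y \<in> A"
    and gf: "\<And>x. x \<in> A \<Longrightarrow> g (f x) = x" and fg: "\<And>y. y \<in> B \<Longrightarrow> f (g y) = y"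
    and rs: "\<And>x y. x \<in> A \<Longrightarrow> y \<in> A \<Longrightarrow> (x, y) \<in> r \<longleftrightarrow> (f x, f y) \<in> s"
  shows "poset_isomorphism A r B s f" and "poset_isomorphism B s A r g"
proof -
  have refl_s: "(y, y) \<in> s" if "y \<in> B" for y
    using s that by (auto simp: partial_order_on_def preorder_on_def refl_on_def)
  have "trans s" "antisym s" using s by (auto simp: partial_order_on_def preorder_on_def)
  have "refl_on A r"
    using r rs f refl_s by (auto simp: refl_on_def)
  moreover have "trans r"
  proof (rule transI)
    fix x y z assume xy: "(x, y) \<in> r" and yz: "(y, z) \<in> r"
    then have "x \<in> A" "y \<in> A" "z \<in> A" using r by auto
    then show "(x, z) \<in> r"
      using xy yz rs transD[OF \<open>trans s\<close>] by blast
  qed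
  moreover have "antisym r"
  proof (rule antisymI)
    fix x y assume xy: "(x, y) \<in> r" and yx: "(y, x) \<in> r"
    then have A: "x \<in> A" "y \<in> A" using r by auto
    then have "f x = f y"
      using xy yx rs antisymD[OF \<open>antisym s\<close>] by blast
    then show "x = y" using gf A by metis
  qed
  ultimately have r_po: "partial_order_on A r"
    using r by (simp add: partial_order_on_def preorder_on_def)
  have "bij_betw f A B" "bij_betw g B A"
    using f g gf fg by (auto intro!: bij_betw_byWitness[where f' = g]
        bij_betw_byWitness[where f' = f])
  then show "poset_isomorphism A r B s f" "poset_isomorphism B s A r g"
    using s r_po rs g fg by (simp_all add: poset_isomorphism_def)
qed

theorem theorem7p26:
  fixes n k :: nat
  assumes "k > 0" and "n > k"
  shows "\<psi> n k \<in> P n k \<rightarrow> C n k \<and>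
         \<sigma> n k \<in> C n k \<rightarrow> P n k \<and>
         poset_isomorphism (P n k) (P_order n k) (C n k) (C_order n k) (\<psi> n k) \<and>
         poset_isomorphism (C n k) (C_order n k) (P n k) (P_order n k) (\<sigma> n k) \<and>
         (\<forall>\<S>\<in>P n k. \<sigma> n k (\<psi> n k \<S>) = \<S>) \<and>
         (\<forall>\<D>\<in>C n k. \<psi> n k (\<sigma> n k \<D>) = \<D>)"
proof -
  have \<psi>_\<sigma>': "\<psi> n k (\<sigma> n k \<D>) = \<D>" if "\<D> \<in> C n k" for \<D>
    using that by (intro \<psi>_\<sigma>) (simp add: C_def concurrency_closed_def)
  have C_po: "partial_order_on (C n k) (C_order n k)"
    by (auto simp: partial_order_on_def preorder_on_def refl_on_def C_order_def
        intro: transI antisymI)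
  have iff: "(\<S>, \<T>) \<in> P_order n k \<longleftrightarrow> (\<psi> n k \<S>, \<psi> n k \<T>) \<in> C_order n k"
    if "\<S> \<in> P n k" "\<T> \<in> P n k" for \<S> \<T>
    using that P_order_iff_\<psi>_subset \<psi>_in_C by (simp add: C_order_def)
  have P_sub: "P_order n k \<subseteq> P n k \<times> P n k"
    by (auto simp: P_order_def)
  note isos = poset_isomorphism_inverse_pair[OF C_po P_sub \<psi>_in_C \<sigma>_in_P \<sigma>_\<psi> \<psi>_\<sigma>' iff]
  show ?thesis
    using isos \<psi>_in_C \<sigma>_in_P \<sigma>_\<psi> \<psi>_\<sigma>' by blast
qed

end
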